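(* Let $Z=(U,\Omega,r)$ be a non-degenerate multimatroid and let $\prec$ be a total ordering of its skew classes. Then \[ Q(Z;\mathbf x,t)= \sum_{B\in \mathcal B(Z)} \Bigg(\prod_{\omega \in \mathrm{inact}_{\prec}(B)} \mathbf x_{B_{\omega}}\Bigg) \Bigg(\prod_{\omega \in \mathrm{act}_{\prec}(B)} \Big(\frac {t\,\mathbf x_{\underline B_{\omega}}} {|\omega|-1}+\mathbf x_{B_{\omega}}\Big)\Bigg),\] where $\mathcal B(Z)$ is the set of bases of $Z$.
   Context: A carrier is a pair $(U,\Omega)$ with $U$ a finite set and $\Omega$ a partition of $U$ into non-empty blocks called skew classes. A skew pair is a pair of distinct elements of the same skew class. A subtransversal is a subset of $U$ meeting each skew class at most once; a transversal meets every skew class exactly once. A multimatroid $Z=(U,\Omega,r)$ consists of a carrier and a non-negative integer function $r$ on subtransversals such that (R1) for every transversal $T$, $T$ with $r$ restricted to subsets of $T$ is a matroid (given by its rank function); (R2) for every subtransversal $S$ and skew pair $\{x,y\}$ from a skew class disjoint from $S$, $r(S\cup\{x\})+r(S\cup\{y\})-2r(S)\ge 1$. The nullity is $n(S)=|S|-r(S)$; $S$ is independent if $n(S)=0$, a basis is a maximal independent subtransversal, a circuit is a minimal dependent subtransversal. $Z$ is non-degenerate if every skew class has at least two elements; then bases are transversals. For a subtransversal $S$ meeting $\omega$, $S_\omega$ is the unique element of $S\cap\omega$. For a basis $B$ and skew class $\omega$, $B\cup\omega$ contains at most one circuit; if it exists it is called the fundamental circuit $C(B,\omega)$, and $\underline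 B_\omega$ denotes the unique element of $C(B,\omega)-B$. A total ordering $\prec$ of the skew classes induces a total ordering of the elements of any subtransversal $S$; $\min(S)$ is its least element. A skew class $\omega$ is active with respect to a basis $B$ if $C(B,\omega)$ exists and $\min(C(B,\omega))\in\omega$; otherwise it is inactive. $\mathrm{act}_\prec(B)$ and $\mathrm{inact}_\prec(B)$ are the sets of active and inactive skew classes. The weighted transition polynomial is $Q(Z;\mathbf x,t)=\sum_{T} t^{n(T)}\mathbf x_T$, the sum over all transversals $T$, where $\mathbf x=(\mathbf x_u)_{u\in U}$ are indeterminates and $\mathbf x_T=\prod_{u\in T}\mathbf x_u$. *)

theory Defs
  imports Complex_Main "HOL-Library.Disjoint_Sets" "HOL-Library.Poly_Mapping"
begin

locale mm_carrier =
  fixes U :: "'a set" and \<Omega> :: "'a set set"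
  assumes finite_ground: "finite U"
    and partition: "partition_on U \<Omega>"

definition subtransversal :: "'a set \<Rightarrow> 'a set set \<Rightarrow> 'a set \<Rightarrow> bool" where
  "subtransversal U \<Omega> S \<longleftrightarrow> S \<subseteq> U \<and> (\<forall>\<omega>\<in>\<Omega>. card (S \<inter> \<omega>) \<le> 1)"

definition transversal :: "'a set \<Rightarrow> 'a set set \<Rightarrow> 'a set \<Rightarrow> bool" where
  "transversal U \<Omega> T \<longleftrightarrow> T \<subseteq> U \<and> (\<forall>\<omega>\<in>\<Omega>. card (T \<inter> \<omega>) = 1)"

definition matroid_rank_function :: "'a set \<Rightarrow> ('a set \<Rightarrow> nat) \<Rightarrow> bool" where
  "matroid_rank_function E r \<longleftrightarrow> finite E \<and>
     (\<forall>X. X \<subseteq> E \<longrightarrow> r X \<le> card X) \<and>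
     (\<forall>X Y. X \<subseteq> Y \<and> Y \<subseteq> E \<longrightarrow> r X \<le> r Y) \<and>
     (\<forall>X Y. X \<subseteq> E \<and> Y \<subseteq> E \<longrightarrow> r (X \<union> Y) + r (X \<inter> Y) \<le> r X + r Y)"

text \<open>The values of \<open>r\<close> on sets that are not subtransversals are irrelevant.\<close>

locale multimatroid = mm_carrier U \<Omega>
  for U :: "'a set" and \<Omega> :: "'a set set" +
  fixes r :: "'a set \<Rightarrow> nat"
  assumes R1: "transversal U \<Omega> T \<Longrightarrow> matroid_rank_function T r"
    and R2: "\<lbrakk>subtransversal U \<Omega> S; \<omega> \<in> \<Omega>; \<omega> \<inter> S = {}; x \<in> \<omega>; y \<in> \<omega>; x \<noteq> y\<rbrakk>
      \<Longrightarrow> int (r (S \<union> {x})) + int (r (S \<union> {y})) - 2 * int (r S) \<ge> 1"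

definition non_degenerate :: "'a set set \<Rightarrow> bool" where
  "non_degenerate \<Omega> \<longleftrightarrow> (\<forall>\<omega>\<in>\<Omega>. card \<omega> \<ge> 2)"

text \<open>The subtraction does not truncate on subtransversals of a multimatroid: each of them is
  contained in a transversal, so \<open>r S \<le> card S\<close> by \<open>R1\<close>.\<close>

definition nullity :: "('a set \<Rightarrow> nat) \<Rightarrow> 'a set \<Rightarrow> nat" where
  "nullity r S = card S - r S"

definition mm_independent :: "'a set \<Rightarrow> 'a set set \<Rightarrow> ('a set \<Rightarrow> nat) \<Rightarrow> 'a set \<Rightarrow> bool" where
  "mm_independent U \<Omega> r S \<longleftrightarrow> subtransversal U \<Omega> S \<and> nullity r S = 0"

definition mm_dependent :: "'a set \<Rightarrow> 'a set set \<Rightarrow> ('a set \<Rightarrow> nat) \<Rightarrow> 'a set \<Rightarrow> bool" where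
  "mm_dependent U \<Omega> r S \<longleftrightarrow> subtransversal U \<Omega> S \<and> nullity r S \<noteq> 0"

definition mm_basis :: "'a set \<Rightarrow> 'a set set \<Rightarrow> ('a set \<Rightarrow> nat) \<Rightarrow> 'a set \<Rightarrow> bool" where
  "mm_basis U \<Omega> r B \<longleftrightarrow> mm_independent U \<Omega> r B \<and>
     (\<forall>S. mm_independent U \<Omega> r S \<and> B \<subseteq> S \<longrightarrow> S = B)"

definition mm_circuit :: "'a set \<Rightarrow> 'a set set \<Rightarrow> ('a set \<Rightarrow> nat) \<Rightarrow> 'a set \<Rightarrow> bool" where
  "mm_circuit U \<Omega> r C \<longleftrightarrow> mm_dependent U \<Omega> r C \<and>
     (\<forall>S. mm_dependent U \<Omega> r S \<and> S \<subseteq> C \<longrightarrow> S = C)"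

text \<open>\<open>S\<^sub>\<omega>\<close>, for a subtransversal \<open>S\<close> that meets \<open>\<omega>\<close>.\<close>

definition elem_in_class :: "'a set \<Rightarrow> 'a set \<Rightarrow> 'a" where
  "elem_in_class S \<omega> = the_elem (S \<inter> \<omega>)"

definition has_fundamental_circuit ::
  "'a set \<Rightarrow> 'a set set \<Rightarrow> ('a set \<Rightarrow> nat) \<Rightarrow> 'a set \<Rightarrow> 'a set \<Rightarrow> bool" where
  "has_fundamental_circuit U \<Omega> r B \<omega> \<longleftrightarrow> (\<exists>C. mm_circuit U \<Omega> r C \<and> C \<subseteq> B \<union> \<omega>)"

text \<open>\<open>C(B,\<omega>)\<close>; only meaningful if \<open>B \<union> \<omega>\<close> contains a circuit, which is then unique.\<close>

definition fundamental_circuit ::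
  "'a set \<Rightarrow> 'a set set \<Rightarrow> ('a set \<Rightarrow> nat) \<Rightarrow> 'a set \<Rightarrow> 'a set \<Rightarrow> 'a set" where
  "fundamental_circuit U \<Omega> r B \<omega> = (THE C. mm_circuit U \<Omega> r C \<and> C \<subseteq> B \<union> \<omega>)"

text \<open>The unique element of \<open>C(B,\<omega>) - B\<close>, when \<open>C(B,\<omega>)\<close> exists.\<close>

definition exchange_elem ::
  "'a set \<Rightarrow> 'a set set \<Rightarrow> ('a set \<Rightarrow> nat) \<Rightarrow> 'a set \<Rightarrow> 'a set \<Rightarrow> 'a" where
  "exchange_elem U \<Omega> r B \<omega> = the_elem (fundamental_circuit U \<Omega> r B \<omega> - B)"

definition skew_class_of :: "'a set set \<Rightarrow> 'a \<Rightarrow> 'a set" where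
  "skew_class_of \<Omega> u = (THE \<omega>. \<omega> \<in> \<Omega> \<and> u \<in> \<omega>)"

text \<open>A strict order \<open>\<prec>\<close> on the skew classes is given as the set \<open>R\<close> of all pairs
  \<open>(\<omega>, \<omega>')\<close> with \<open>\<omega> \<prec> \<omega>'\<close>.\<close>

definition min_elem :: "'a set set \<Rightarrow> ('a set \<times> 'a set) set \<Rightarrow> 'a set \<Rightarrow> 'a" where
  "min_elem \<Omega> R S =
     (THE u. u \<in> S \<and> (\<forall>v\<in>S. v \<noteq> u \<longrightarrow> (skew_class_of \<Omega> u, skew_class_of \<Omega> v) \<in> R))"

definition act ::
  "'a set \<Rightarrow> 'a set set \<Rightarrow> ('a set \<Rightarrow> nat) \<Rightarrow> ('a set \<times> 'a set) set \<Rightarrow> 'a set \<Rightarrow> 'a set set" where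
  "act U \<Omega> r R B = {\<omega> \<in> \<Omega>. has_fundamental_circuit U \<Omega> r B \<omega> \<and>
     min_elem \<Omega> R (fundamental_circuit U \<Omega> r B \<omega>) \<in> \<omega>}"

definition inact ::
  "'a set \<Rightarrow> 'a set set \<Rightarrow> ('a set \<Rightarrow> nat) \<Rightarrow> ('a set \<times> 'a set) set \<Rightarrow> 'a set \<Rightarrow> 'a set set" where
  "inact U \<Omega> r R B = \<Omega> - act U \<Omega> r R B"

text \<open>Polynomials in the indeterminates \<open>x\<^sub>u\<close> and \<open>t\<close> over \<open>'k\<close>: finitely supported maps
  from monomials (exponent vectors) to coefficients, multiplied by convolution.\<close>

datatype 'a indet = XVar 'a | TVar

type_synonym ('a, 'k) mpoly = "('a indet \<Rightarrow>\<^sub>0 nat) \<Rightarrow>\<^sub>0 'k"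

definition mconst :: "'k::comm_ring_1 \<Rightarrow> ('a, 'k) mpoly" where
  "mconst c = Poly_Mapping.single 0 c"

definition x_var :: "'a \<Rightarrow> ('a, 'k::comm_ring_1) mpoly" where
  "x_var u = Poly_Mapping.single (Poly_Mapping.single (XVar u) 1) 1"

definition t_var :: "('a, 'k::comm_ring_1) mpoly" where
  "t_var = Poly_Mapping.single (Poly_Mapping.single TVar 1) 1"

definition transition_poly ::
  "'a set \<Rightarrow> 'a set set \<Rightarrow> ('a set \<Rightarrow> nat) \<Rightarrow> ('a, 'k::comm_ring_1) mpoly" where
  "transition_poly U \<Omega> r =
     (\<Sum>T | transversal U \<Omega> T. t_var ^ nullity r T * (\<Prod>u\<in>T. x_var u))"

end

theory Submission
  imports Defs
begin

text \<open>
  Choose the elements of a transversal class by class, from the largest skew class to the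
  smallest. Whether \<open>\<omega>\<close> is active for a basis \<open>B\<close> depends only on the part \<open>X\<close> of \<open>B\<close> in the
  classes above \<open>\<omega>\<close>: it means that some \<open>y \<in> \<omega>\<close> is a loop over \<open>X\<close>, i.e. \<open>r (X \<union> {y}) = r X\<close>,
  and then \<open>y\<close> is the exchange element. If there is no loop in \<open>\<omega>\<close>, the sums over transversals
  and over bases branch in the same way. If \<open>y\<close> is a loop, then by R2 every other element of
  \<open>\<omega>\<close> raises the rank of every larger set by one, so all choices in \<open>\<omega>\<close> leave the same contracted
  rank function on the remaining classes; the term \<open>t x\<^sub>y\<close> of the transversal sum can thus be
  distributed equally among the \<open>|\<omega>| - 1\<close> other choices, which gives the basis sum.
\<close>

section \<open>Sums over transversals, split along one skew class\<close>

lemma transversal_insert_iff: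
  assumes "\<omega> \<inter> \<Union>A = {}"
  shows "transversal (\<Union>(insert \<omega> A)) (insert \<omega> A) T \<longleftrightarrow>
    (\<exists>u T'. u \<in> \<omega> \<and> transversal (\<Union>A) A T' \<and> T = insert u T')" (is "?l \<longleftrightarrow> ?r")
proof
  assume l: ?l
  then obtain u where u: "T \<inter> \<omega> = {u}"
    by (auto simp: transversal_def card_1_singleton_iff)
  have "(T - {u}) \<inter> \<omega>' = T \<inter> \<omega>'" if "\<omega>' \<in> A" for \<omega>'
    using u that assms by auto
  then have "transversal (\<Union>A) A (T - {u})"
    using l u by (auto simp: transversal_def)
  then show ?r
    using u by (intro exI[of _ u] exI[of _ "T - {u}"]) auto
next
  assume ?r
  then obtain u T' where u: "u \<in> \<omega>" "transversal (\<Union>A) A T'" "T = insert u T'" by blast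
  have T\<omega>: "insert u T' \<inter> \<omega> = {u}"
    using u assms by (auto simp: transversal_def)
  have TA: "insert u T' \<inter> \<omega>' = T' \<inter> \<omega>'" if "\<omega>' \<in> A" for \<omega>'
    using u assms that by auto
  have "insert u T' \<subseteq> \<Union>(insert \<omega> A)"
    using u(1,2) by (auto simp: transversal_def)
  moreover have "card (insert u T' \<inter> \<omega>') = 1" if "\<omega>' \<in> insert \<omega> A" for \<omega>'
  proof (cases "\<omega>' = \<omega>")
    case True
    then show ?thesis by (simp only: T\<omega>) simp
  next
    case False
    with that have "\<omega>' \<in> A" by simp
    with u(2) show ?thesis by (simp only: TA transversal_def)
  qed
  ultimately show ?l
    unfolding u(3) transversal_def by blast
qed

text \<open>Each transversal of the enlarged family comes from exactly one pair
  \<open>(u, T)\<close>: since \<omega> is disjoint from the other classes, \<open>T\<close> avoids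
  it and \<open>u\<close> is recovered as the only element in it. Both recursions over the skew
  classes rest on this bijection.\<close>

lemma sum_transversal_insert:
  assumes "\<omega> \<inter> \<Union>A = {}"
  shows "(\<Sum>T | transversal (\<Union>(insert \<omega> A)) (insert \<omega> A) T. f T) =
    (\<Sum>u\<in>\<omega>. \<Sum>T | transversal (\<Union>A) A T. f (insert u T))"
proof -
  have sub: "T \<inter> \<omega> = {}" if "transversal (\<Union>A) A T" for T
    using that assms by (auto simp: transversal_def)
  have "inj_on (\<lambda>(u, T). insert u T) (\<omega> \<times> {T. transversal (\<Union>A) A T})"
  proof (rule inj_onI, clarify)
    fix u T u' T'
    assume *: "u \<in> \<omega>" "u' \<in> \<omega>" "transversal (\<Union>A) A T" "transversal (\<Union>A) A T'"
      "insert u T = insert u' T'"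
    then have "u \<notin> T" "u \<notin> T'" "u' \<notin> T" "u' \<notin> T'"
      using sub by blast+
    with * show "u = u' \<and> T = T'" by (metis insert_ident insertE insertI1)
  qed
  moreover have "(\<lambda>(u, T). insert u T) ` (\<omega> \<times> {T. transversal (\<Union>A) A T}) =
      {T. transversal (\<Union>(insert \<omega> A)) (insert \<omega> A) T}"
    unfolding transversal_insert_iff[OF assms] by auto
  ultimately have "bij_betw (\<lambda>(u, T). insert u T) (\<omega> \<times> {T. transversal (\<Union>A) A T})
      {T. transversal (\<Union>(insert \<omega> A)) (insert \<omega> A) T}"
    by (simp add: bij_betw_def)
  from sum.reindex_bij_betw[OF this, of f] show ?thesis
    by (simp add: sum.cartesian_product case_prod_unfold)
qed

section \<open>Skew classes and subtransversals\<close>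

context multimatroid
begin

lemma class_subset: "\<omega> \<in> \<Omega> \<Longrightarrow> \<omega> \<subseteq> U"
  using partition by (auto simp: partition_on_def)

lemma class_eq: "\<lbrakk>\<omega> \<in> \<Omega>; \<omega>' \<in> \<Omega>; u \<in> \<omega>; u \<in> \<omega>'\<rbrakk> \<Longrightarrow> \<omega> = \<omega>'"
  using partition by (auto simp: partition_on_def disjoint_def)

lemma finite_classes: "finite \<Omega>"
  using partition finite_ground by (metis finite_UnionD partition_on_def)

lemma skew_class_of_eq: "\<lbrakk>\<omega> \<in> \<Omega>; u \<in> \<omega>\<rbrakk> \<Longrightarrow> skew_class_of \<Omega> u = \<omega>"
  unfolding skew_class_of_def by (rule the_equality) (auto dest: class_eq)

lemma subtransversal_iff:
  "subtransversal U \<Omega> S \<longleftrightarrow>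
    S \<subseteq> U \<and> (\<forall>\<omega>\<in>\<Omega>. \<forall>x\<in>S \<inter> \<omega>. \<forall>y\<in>S \<inter> \<omega>. x = y)"
proof (cases "S \<subseteq> U")
  case True
  then have "finite (S \<inter> \<omega>)" for \<omega>
    using finite_ground finite_subset by auto
  then have "card (S \<inter> \<omega>) \<le> 1 \<longleftrightarrow> (\<forall>x\<in>S \<inter> \<omega>. \<forall>y\<in>S \<inter> \<omega>. x = y)" for \<omega>
    using card_le_Suc0_iff_eq[of "S \<inter> \<omega>"] by simp
  then show ?thesis
    by (simp add: subtransversal_def)
qed (simp add: subtransversal_def)

lemma subtransversal_subset: "\<lbrakk>subtransversal U \<Omega> S; S' \<subseteq> S\<rbrakk> \<Longrightarrow> subtransversal U \<Omega> S'"
  unfolding subtransversal_iff by (meson Int_mono order_refl subsetD subset_trans)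

lemma subtransversal_insert:
  assumes S: "subtransversal U \<Omega> S" and \<omega>: "\<omega> \<in> \<Omega>" "\<omega> \<inter> S = {}" "u \<in> \<omega>"
  shows "subtransversal U \<Omega> (insert u S)"
proof -
  have "v \<notin> \<omega>'" if "\<omega>' \<in> \<Omega>" "u \<in> \<omega>'" "v \<in> S" for v \<omega>'
    using class_eq[OF \<omega>(1) that(1) \<omega>(3) that(2)] \<omega>(2) that(3) by blast
  moreover have "u \<in> U" using class_subset \<omega> by blast
  ultimately show ?thesis
    using S unfolding subtransversal_iff by (metis Int_iff insert_iff insert_subset)
qed

text \<open>No class meets both parts: blocks are disjoint and \<open>T\<close> lies in
  \<open>\<Union>A\<close>, so a class that meets \<open>T\<close> belongs to \<open>A\<close>,
  while \<open>S\<close> avoids all classes in \<open>A\<close>.\<close>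

lemma subtransversal_Un:
  assumes "subtransversal U \<Omega> S" "A \<subseteq> \<Omega>" "S \<inter> \<Union>A = {}" "transversal (\<Union>A) A T"
  shows "subtransversal U \<Omega> (S \<union> T)"
proof -
  have 1: "x = y" if "x \<in> T" "y \<in> T" "x \<in> \<omega>" "y \<in> \<omega>" "\<omega> \<in> \<Omega>" for x y \<omega>
  proof -
    have "x \<in> \<Union>A"
      using assms(4) that(1) by (auto simp: transversal_def)
    then obtain \<omega>' where "\<omega>' \<in> A" "x \<in> \<omega>'" by blast
    with assms(2) that class_eq have "\<omega> \<in> A" by blast
    then obtain z where "T \<inter> \<omega> = {z}"
      using assms(4) by (auto simp: transversal_def card_1_singleton_iff)
    with that show ?thesis by (metis IntI singletonD)
  qed
  have T: "T \<subseteq> \<Union>A" using assms(4) by (simp add: transversal_def)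
  have 2: "y \<notin> S" if "x \<in> T" "x \<in> \<omega>" "y \<in> \<omega>" "\<omega> \<in> \<Omega>" for x y \<omega>
  proof -
    obtain \<omega>' where "\<omega>' \<in> A" "x \<in> \<omega>'" using T \<open>x \<in> T\<close> by blast
    then have "\<omega> \<in> A" using assms(2) that class_eq by blast
    with that assms(3) show ?thesis by blast
  qed
  have 3: "T \<subseteq> U"
    using T assms(2) class_subset by blast
  have 4: "x = y" if "x \<in> S" "y \<in> S" "x \<in> \<omega>" "y \<in> \<omega>" "\<omega> \<in> \<Omega>" for x y \<omega>
    using assms(1) that unfolding subtransversal_iff by blast
  have "x = y" if "x \<in> S \<union> T" "y \<in> S \<union> T" "x \<in> \<omega>" "y \<in> \<omega>" "\<omega> \<in> \<Omega>" for x y \<omega>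
    using that 1 2 4 by (metis Un_iff)
  then show ?thesis
    using assms(1) 3 unfolding subtransversal_iff by (intro conjI ballI) blast+
qed

lemma finite_subtransversal: "subtransversal U \<Omega> S \<Longrightarrow> finite S"
  using finite_ground finite_subset by (auto simp: subtransversal_def)

lemma transversal_imp_subtransversal: "transversal U \<Omega> T \<Longrightarrow> subtransversal U \<Omega> T"
  by (simp add: transversal_def subtransversal_def)

text \<open>Blocks are non-empty, so \<open>S\<close> can be completed by one chosen element from
  each class that it misses. This transfers the matroid rank axioms of R1 from transversals to
  arbitrary subtransversals.\<close>

lemma subtransversal_extend:
  assumes "subtransversal U \<Omega> S"
  obtains T where "transversal U \<Omega> T" "S \<subseteq> T"
proof
  define pick :: "'a set \<Rightarrow> 'a" where "pick = (\<lambda>\<omega>. SOME x. x \<in> \<omega>)"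
  have pick: "pick \<omega> \<in> \<omega>" if "\<omega> \<in> \<Omega>" for \<omega>
    using that partition unfolding pick_def
    by (metis partition_on_def some_in_eq)
  let ?T = "S \<union> pick ` {\<omega> \<in> \<Omega>. S \<inter> \<omega> = {}}"
  have "card (?T \<inter> \<omega>) = 1" if "\<omega> \<in> \<Omega>" for \<omega>
  proof (cases "S \<inter> \<omega> = {}")
    case True
    have "?T \<inter> \<omega> = {pick \<omega>}"
      using True that pick class_eq by blast
    then show ?thesis by simp
  next
    case False
    have "?T \<inter> \<omega> = S \<inter> \<omega>"
      using False that pick class_eq by blast
    moreover have "card (S \<inter> \<omega>) \<le> 1" "card (S \<inter> \<omega>) \<noteq> 0"
      using assms that False finite_subtransversal[OF assms]
      by (auto simp: subtransversal_def)
    ultimately show ?thesis by simp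
  qed
  moreover have "?T \<subseteq> U"
    using assms pick class_subset by (auto simp: subtransversal_def)
  ultimately show "transversal U \<Omega> ?T"
    by (simp add: transversal_def)
qed simp

section \<open>Rank inequalities on subtransversals\<close>

lemma rank_function_on_superset:
  assumes "subtransversal U \<Omega> S"
  obtains T where "matroid_rank_function T r" "S \<subseteq> T"
  using subtransversal_extend[OF assms] R1 by metis

lemma rank_le_card: "subtransversal U \<Omega> S \<Longrightarrow> r S \<le> card S"
  by (erule rank_function_on_superset) (simp add: matroid_rank_function_def)

lemma rank_mono: "\<lbrakk>subtransversal U \<Omega> Y; X \<subseteq> Y\<rbrakk> \<Longrightarrow> r X \<le> r Y"
  by (erule rank_function_on_superset) (simp add: matroid_rank_function_def)

lemma rank_submodular:
  "subtransversal U \<Omega> (X \<union> Y) \<Longrightarrow> r (X \<union> Y) + r (X \<inter> Y) \<le> r X + r Y"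
  by (erule rank_function_on_superset) (simp add: matroid_rank_function_def)

lemma rank_Un_le:
  assumes "subtransversal U \<Omega> (X \<union> Y)"
  shows "r (X \<union> Y) \<le> r X + card Y"
  using rank_submodular[OF assms] rank_le_card[of Y] subtransversal_subset[OF assms, of Y]
  by simp

lemma rank_insert_le: "subtransversal U \<Omega> (insert u S) \<Longrightarrow> r (insert u S) \<le> Suc (r S)"
  using rank_Un_le[of S "{u}"] by simp

text \<open>Submodularity is applied to \<open>insert u S\<close> and \<open>S'\<close>, which
  intersect in \<open>S\<close> when \<open>u\<close> is not in \<open>S'\<close>. Loops over a set
  thus remain loops over larger sets.\<close>

lemma rank_insert_eq_mono:
  assumes "r (insert u S) = r S" "S \<subseteq> S'" "subtransversal U \<Omega> (insert u S')"
  shows "r (insert u S') = r S'"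
proof (cases "u \<in> S'")
  case False
  have "insert u S \<union> S' = insert u S'" "insert u S \<inter> S' = S"
    using assms(2) False by auto
  then have "r (insert u S') \<le> r S'"
    using rank_submodular[of "insert u S" S'] assms by simp
  moreover have "r S' \<le> r (insert u S')"
    using assms(3) by (rule rank_mono) blast
  ultimately show ?thesis by simp
qed (simp add: insert_absorb)

text \<open>In R2 the rank increments of \<open>x\<close> and \<open>y\<close> over \<open>S\<close>
  sum to at least one. That of \<open>x\<close> is zero and no single element adds more than one, so
  that of \<open>y\<close> is exactly one.\<close>

lemma rank_insert_skew:
  assumes "subtransversal U \<Omega> S" "\<omega> \<in> \<Omega>" "\<omega> \<inter> S = {}" "x \<in> \<omega>" "y \<in> \<omega>" "x \<noteq> y"
    and "r (insert x S) = r S"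
  shows "r (insert y S) = Suc (r S)"
  using R2[OF assms(1-6)] assms(7) rank_insert_le[of y S] subtransversal_insert[OF assms(1-3,5)]
  by simp

section \<open>Independence, circuits and bases\<close>

lemma dependent_iff: "mm_dependent U \<Omega> r S \<longleftrightarrow> subtransversal U \<Omega> S \<and> r S < card S"
  by (auto simp: mm_dependent_def nullity_def)

lemma independent_iff: "mm_independent U \<Omega> r S \<longleftrightarrow> subtransversal U \<Omega> S \<and> r S = card S"
  using rank_le_card[of S] by (auto simp: mm_independent_def nullity_def)

text \<open>Adding the elements of \<open>S - S'\<close> raises the rank by at most their number, so
  a rank deficit of \<open>S'\<close> would persist in \<open>S\<close>.\<close>

lemma independent_subset:
  assumes "mm_independent U \<Omega> r S" "S' \<subseteq> S"
  shows "mm_independent U \<Omega> r S'"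
proof -
  have S: "subtransversal U \<Omega> S" "r S = card S"
    using assms by (auto simp: independent_iff)
  then have S': "subtransversal U \<Omega> S'"
    using assms(2) subtransversal_subset by blast
  have "S' \<union> (S - S') = S" using assms(2) by auto
  then have "card S \<le> r S' + card (S - S')"
    using rank_Un_le[of S' "S - S'"] S by simp
  moreover have "card (S - S') = card S - card S'" "card S' \<le> card S"
    using assms(2) finite_subtransversal[OF S(1)] finite_subtransversal[OF S']
    by (auto simp: card_Diff_subset card_mono)
  ultimately have "card S' \<le> r S'" by simp
  then show ?thesis
    using S' rank_le_card[OF S'] by (simp add: independent_iff)
qed

lemma dependent_not_subset_independent:
  "\<lbrakk>mm_dependent U \<Omega> r C; mm_independent U \<Omega> r S\<rbrakk> \<Longrightarrow> \<not> C \<subseteq> S"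
  using independent_subset[of S C] by (auto simp: dependent_iff independent_iff)

lemma dependent_contains_circuit:
  assumes "mm_dependent U \<Omega> r S"
  obtains C where "mm_circuit U \<Omega> r C" "C \<subseteq> S"
proof -
  have "finite {C. mm_dependent U \<Omega> r C \<and> C \<subseteq> S}"
    using assms finite_subtransversal by (auto simp: dependent_iff)
  from finite_has_minimal2[OF this, of S] assms
  obtain C where C: "mm_dependent U \<Omega> r C" "C \<subseteq> S"
    and min: "\<And>D. \<lbrakk>mm_dependent U \<Omega> r D; D \<subseteq> S; D \<subseteq> C\<rbrakk> \<Longrightarrow> C = D"
    by auto
  then have "mm_circuit U \<Omega> r C"
    unfolding mm_circuit_def by blast
  with that C(2) show ?thesis by blast
qed

text \<open>If a maximal independent set missed a class, every element of that class would leave its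
  rank unchanged. Non-degeneracy provides two such elements, contrary to R2. Conversely, no
  subtransversal properly contains a transversal.\<close>

lemma basis_iff:
  assumes "non_degenerate \<Omega>"
  shows "mm_basis U \<Omega> r B \<longleftrightarrow> transversal U \<Omega> B \<and> r B = card B"
proof
  assume basis: "mm_basis U \<Omega> r B"
  then have B: "subtransversal U \<Omega> B" "r B = card B"
    by (auto simp: mm_basis_def independent_iff)
  have "B \<inter> \<omega> \<noteq> {}" if "\<omega> \<in> \<Omega>" for \<omega>
  proof
    assume disj: "B \<inter> \<omega> = {}"
    have "2 \<le> card \<omega>" using assms that by (simp add: non_degenerate_def)
    then obtain x y where xy: "x \<in> \<omega>" "y \<in> \<omega>" "x \<noteq> y"
      by (metis One_nat_def card_le_Suc0_iff_eq card.infinite not_less_eq_eq numeral_2_eq_2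
          zero_le)
    have max: "r (insert z B) = r B" if "z \<in> \<omega>" for z
    proof (rule ccontr)
      assume neq: "r (insert z B) \<noteq> r B"
      have sub: "subtransversal U \<Omega> (insert z B)"
        using B(1) \<open>\<omega> \<in> \<Omega>\<close> disj that subtransversal_insert by blast
      then have "r (insert z B) = Suc (card B)"
        using neq rank_insert_le[OF sub] rank_mono[OF sub subset_insertI] B(2) by auto
      then have "mm_independent U \<Omega> r (insert z B)"
        using sub rank_le_card[OF sub] finite_subtransversal[OF B(1)]
        by (simp add: independent_iff card_insert_if split: if_splits)
      then have "insert z B = B"
        using basis by (auto simp: mm_basis_def)
      then show False using that disj by blast
    qed
    from rank_insert_skew[OF B(1) that _ xy max] disj max xy show False by auto
  qed
  then have "card (B \<inter> \<omega>) = 1" if "\<omega> \<in> \<Omega>" for \<omega>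
    using B(1) that finite_subtransversal[OF B(1)]
    by (metis One_nat_def card_0_eq finite_Int le_Suc_eq le_zero_eq subtransversal_def)
  then show "transversal U \<Omega> B \<and> r B = card B"
    using B by (simp add: transversal_def subtransversal_def)
next
  assume B: "transversal U \<Omega> B \<and> r B = card B"
  have "S = B" if "subtransversal U \<Omega> S" "B \<subseteq> S" for S
  proof -
    have "x \<in> B" if "x \<in> S" for x
    proof -
      have "x \<in> U" using \<open>subtransversal U \<Omega> S\<close> \<open>x \<in> S\<close> by (auto simp: subtransversal_def)
      then obtain \<omega> where \<omega>: "\<omega> \<in> \<Omega>" "x \<in> \<omega>"
        using partition by (auto simp: partition_on_def)
      then obtain z where "B \<inter> \<omega> = {z}"
        using B by (auto simp: transversal_def card_1_singleton_iff)
      with \<omega> \<open>x \<in> S\<close> \<open>B \<subseteq> S\<close> \<open>subtransversal U \<Omega> S\<close> show ?thesis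
        unfolding subtransversal_iff by blast
    qed
    with that show ?thesis by blast
  qed
  then show "mm_basis U \<Omega> r B"
    using B transversal_imp_subtransversal by (auto simp: mm_basis_def independent_iff)
qed

text \<open>Both circuits pass through the same element \<open>y\<close> of \<omega>, the only loop
  there over \<open>B - \<omega>\<close>. If they differed, their intersection would be independent
  and their union would lose at most one in rank, whereas submodularity bounds the sum of these two
  ranks by \<open>card C + card D - 2\<close>.\<close>

lemma fundamental_circuit_unique:
  assumes B: "mm_independent U \<Omega> r B" and \<omega>: "\<omega> \<in> \<Omega>"
    and C: "mm_circuit U \<Omega> r C" "C \<subseteq> B \<union> \<omega>"
    and D: "mm_circuit U \<Omega> r D" "D \<subseteq> B \<union> \<omega>"
  shows "C = D"
proof (rule ccontr)
  assume neq: "C \<noteq> D"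
  let ?X = "B - \<omega>"
  have X: "subtransversal U \<Omega> ?X" "r ?X = card ?X"
    using independent_subset[OF B, of ?X] by (auto simp: independent_iff)
  have disj: "\<omega> \<inter> ?X = {}" by blast
  \<comment> \<open>A circuit is not contained in the independent set \<open>B\<close>, so it meets
    \<omega>, and only once because it is a subtransversal. Its remaining elements lie in
    \<open>?X\<close>, and its dependence prevents \<open>y\<close> from raising the rank of
    \<open>?X\<close>.\<close>
  have *: "\<exists>y\<in>\<omega>. y \<in> C \<and> C \<subseteq> insert y ?X \<and> r (insert y ?X) = r ?X"
    if C: "mm_circuit U \<Omega> r C" "C \<subseteq> B \<union> \<omega>" for C
  proof -
    have dep: "mm_dependent U \<Omega> r C" using C by (simp add: mm_circuit_def)
    then obtain y where y: "y \<in> C" "y \<in> \<omega>"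
      using dependent_not_subset_independent[OF _ B] C by blast
    have sub: "C \<subseteq> insert y ?X"
      using C y dep \<omega> unfolding dependent_iff subtransversal_iff by blast
    have st: "subtransversal U \<Omega> (insert y ?X)"
      using subtransversal_insert[OF X(1) \<omega> disj y(2)] .
    have "\<not> mm_independent U \<Omega> r (insert y ?X)"
      using dependent_not_subset_independent[OF dep] sub by blast
    then have "r (insert y ?X) < card (insert y ?X)"
      using st rank_le_card[OF st] by (simp add: independent_iff)
    moreover have "card (insert y ?X) = Suc (card ?X)"
      using y finite_subtransversal[OF X(1)] by simp
    ultimately have "r (insert y ?X) = r ?X"
      using rank_mono[OF st subset_insertI] X(2) by auto
    with y sub show ?thesis by blast
  qed
  obtain y where y: "y \<in> \<omega>" "y \<in> C" "C \<subseteq> insert y ?X" "r (insert y ?X) = r ?X"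
    using *[OF C] by blast
  obtain z where z: "z \<in> \<omega>" "z \<in> D" "D \<subseteq> insert z ?X" "r (insert z ?X) = r ?X"
    using *[OF D] by blast
  have "y = z"
    using rank_insert_skew[OF X(1) \<omega> disj y(1) z(1) _ y(4)] z(4) by auto
  have un: "subtransversal U \<Omega> (C \<union> D)"
    using subtransversal_subset[OF subtransversal_insert[OF X(1) \<omega> disj y(1)], of "C \<union> D"]
      y z \<open>y = z\<close> by blast
  then have fin: "finite C" "finite D"
    using finite_subtransversal by auto
  have dep: "r C < card C" "r D < card D"
    using C D by (auto simp: mm_circuit_def dependent_iff)
  \<comment> \<open>By minimality of both circuits, a dependent intersection would equal
    \<open>C\<close> and also \<open>D\<close>.\<close>
  have "\<not> mm_dependent U \<Omega> r (C \<inter> D)"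
    using C D neq unfolding mm_circuit_def by (metis inf.cobounded1 inf.cobounded2)
  then have int: "r (C \<inter> D) = card (C \<inter> D)"
    using subtransversal_subset[OF un, of "C \<inter> D"] rank_le_card[of "C \<inter> D"]
    by (simp add: dependent_iff le_infI1)
  \<comment> \<open>Apart from \<open>y\<close>, both circuits lie in the independent set
    \<open>?X\<close>.\<close>
  have "mm_independent U \<Omega> r (C \<union> D - {y})"
    using independent_subset[of ?X "C \<union> D - {y}"] X y z \<open>y = z\<close>
    by (auto simp: independent_iff)
  then have "card (C \<union> D) - 1 = r (C \<union> D - {y})"
    using y by (simp add: independent_iff)
  also have "\<dots> \<le> r (C \<union> D)"
    using un by (rule rank_mono) blast
  finally have "card (C \<union> D) - 1 + card (C \<inter> D) \<le> r C + r D"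
    using rank_submodular[OF un] int by simp
  then show False
    using dep card_Un_Int[OF fin] by linarith
qed

end

section \<open>The order on skew classes and least elements\<close>

locale ordered_multimatroid = multimatroid U \<Omega> r
  for U :: "'a set" and \<Omega> :: "'a set set" and r :: "'a set \<Rightarrow> nat" +
  fixes R :: "('a set \<times> 'a set) set"
  assumes non_degenerate: "non_degenerate \<Omega>"
    and order: "strict_linear_order_on \<Omega> R"
begin

lemma order_irrefl: "(\<omega>, \<omega>) \<notin> R"
  using order by (simp add: strict_linear_order_on_def irrefl_def)

lemma order_asym: "(\<omega>, \<omega>') \<in> R \<Longrightarrow> (\<omega>', \<omega>) \<notin> R"
  using order order_irrefl unfolding strict_linear_order_on_def by (meson transD)

lemma order_total: "\<lbrakk>\<omega> \<in> \<Omega>; \<omega>' \<in> \<Omega>; \<omega> \<noteq> \<omega>'\<rbrakk> \<Longrightarrow> (\<omega>, \<omega>') \<in> R \<or> (\<omega>', \<omega>) \<in> R"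
  using order by (simp add: strict_linear_order_on_def total_on_def)

lemma greatest_class:
  assumes "A \<subseteq> \<Omega>" "A \<noteq> {}"
  obtains \<omega> where "\<omega> \<in> A" "\<And>\<omega>'. \<omega>' \<in> A - {\<omega>} \<Longrightarrow> (\<omega>', \<omega>) \<in> R"
proof -
  have "asymp_on A (\<lambda>a b. (a, b) \<in> R)" "transp_on A (\<lambda>a b. (a, b) \<in> R)"
    using order order_asym unfolding strict_linear_order_on_def
    by (auto intro!: asymp_onI transp_onI dest: transD)
  from Finite_Set.bex_max_element[OF finite_subset[OF assms(1) finite_classes] this assms(2)]
  obtain \<omega> where "\<omega> \<in> A" "\<forall>\<omega>'\<in>A. \<omega>' \<noteq> \<omega> \<longrightarrow> (\<omega>, \<omega>') \<notin> R" by blast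
  then show ?thesis
    using that assms(1) order_total by (metis Diff_iff insertI1 subsetD)
qed

lemma min_elem_eqI:
  assumes "u \<in> S" "\<And>v. \<lbrakk>v \<in> S; v \<noteq> u\<rbrakk> \<Longrightarrow> (skew_class_of \<Omega> u, skew_class_of \<Omega> v) \<in> R"
  shows "min_elem \<Omega> R S = u"
  unfolding min_elem_def
proof (rule the_equality)
  fix v assume "v \<in> S \<and>
    (\<forall>w\<in>S. w \<noteq> v \<longrightarrow> (skew_class_of \<Omega> v, skew_class_of \<Omega> w) \<in> R)"
  with assms show "v = u" by (metis order_asym)
qed (use assms in blast)

text \<open>Distinct elements of a subtransversal lie in distinct classes, so the order on classes
  is total on its elements, and a minimal element, which exists by finiteness, is the least
  one.\<close>

lemma min_elem_least:
  assumes S: "subtransversal U \<Omega> S" "S \<noteq> {}"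
  shows "min_elem \<Omega> R S \<in> S"
    "\<lbrakk>v \<in> S; v \<noteq> min_elem \<Omega> R S\<rbrakk> \<Longrightarrow>
      (skew_class_of \<Omega> (min_elem \<Omega> R S), skew_class_of \<Omega> v) \<in> R"
proof -
  let ?P = "\<lambda>u v. (skew_class_of \<Omega> u, skew_class_of \<Omega> v) \<in> R"
  have cls: "\<exists>\<omega>\<in>\<Omega>. u \<in> \<omega> \<and> skew_class_of \<Omega> u = \<omega>" if "u \<in> S" for u
    using that S(1) partition skew_class_of_eq
    by (fastforce simp: subtransversal_def partition_on_def)
  have "asymp_on S ?P" "transp_on S ?P"
    using order order_asym unfolding strict_linear_order_on_def
    by (auto intro!: asymp_onI transp_onI dest: transD)
  from Finite_Set.bex_min_element[OF finite_subtransversal[OF S(1)] this S(2)]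
  obtain u where u: "u \<in> S" "\<And>v. \<lbrakk>v \<in> S; v \<noteq> u\<rbrakk> \<Longrightarrow> \<not> ?P v u" by blast
  have P: "?P u v" if v: "v \<in> S" "v \<noteq> u" for v
  proof -
    have "skew_class_of \<Omega> u \<noteq> skew_class_of \<Omega> v"
      using cls[OF u(1)] cls[OF v(1)] u(1) v S(1) unfolding subtransversal_iff by blast
    with cls[OF u(1)] cls[OF v(1)] u(2)[OF v] order_total show ?thesis by blast
  qed
  then have "min_elem \<Omega> R S = u"
    using u(1) by (intro min_elem_eqI)
  with u(1) P show "min_elem \<Omega> R S \<in> S"
    "\<lbrakk>v \<in> S; v \<noteq> min_elem \<Omega> R S\<rbrakk> \<Longrightarrow> ?P (min_elem \<Omega> R S) v" by auto
qed

section \<open>Activity expressed through loops\<close>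

definition above :: "'a set \<Rightarrow> 'a set \<Rightarrow> 'a set" where
  "above B \<omega> = B \<inter> \<Union>{\<omega>' \<in> \<Omega>. (\<omega>, \<omega>') \<in> R}"

text \<open>For \<omega> disjoint from \<open>X\<close>, these are the elements of \<omega> that
  have rank zero in the contraction by \<open>X\<close>.\<close>

definition loops :: "'a set \<Rightarrow> 'a set \<Rightarrow> 'a set" where
  "loops X \<omega> = {y \<in> \<omega>. r (insert y X) = r X}"

lemma above_disjoint: "\<omega> \<in> \<Omega> \<Longrightarrow> \<omega> \<inter> above B \<omega> = {}"
  unfolding above_def using order_irrefl class_eq by blast

text \<open>Two loops in one class would violate R2. This is what makes
  \<open>the_elem (loops X \<omega>)\<close> meaningful whenever a loop exists.\<close>

lemma loops_subset_singleton:
  assumes "subtransversal U \<Omega> X" "\<omega> \<in> \<Omega>" "\<omega> \<inter> X = {}" "y \<in> loops X \<omega>"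
  shows "loops X \<omega> = {y}"
proof -
  have "z = y" if "z \<in> loops X \<omega>" for z
    using rank_insert_skew[OF assms(1-3), of y z] that assms(4) by (auto simp: loops_def)
  with assms(4) show ?thesis by blast
qed

text \<open>Adding \<open>y\<close> to the independent set \<open>above B \<omega>\<close> creates a
  circuit through \<open>y\<close>, which by uniqueness is the fundamental circuit. All its other
  elements lie in \<open>B\<close> and in classes greater than \<omega>, so \<open>y\<close> is both
  its least element and its only element outside \<open>B\<close>.\<close>

lemma above_loop_exchange:
  assumes B: "mm_independent U \<Omega> r B" and \<omega>: "\<omega> \<in> \<Omega>" and y: "y \<in> loops (above B \<omega>) \<omega>"
  shows "\<omega> \<in> act U \<Omega> r R B" "exchange_elem U \<Omega> r B \<omega> = y"
proof -
  let ?X = "above B \<omega>"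
  have XB: "?X \<subseteq> B" by (simp add: above_def)
  have X: "mm_independent U \<Omega> r ?X" "subtransversal U \<Omega> ?X" "r ?X = card ?X"
    using independent_subset[OF B XB] by (auto simp: independent_iff)
  have y: "y \<in> \<omega>" "r (insert y ?X) = r ?X" "y \<notin> ?X"
    using y above_disjoint[OF \<omega>] by (auto simp: loops_def)
  have dep: "mm_dependent U \<Omega> r (insert y ?X)"
    using subtransversal_insert[OF X(2) \<omega> above_disjoint[OF \<omega>] y(1)] y X
      finite_subtransversal[OF X(2)]
    by (simp add: dependent_iff)
  then obtain C where C: "mm_circuit U \<Omega> r C" "C \<subseteq> insert y ?X"
    using dependent_contains_circuit by blast
  have yC: "y \<in> C"
    using C dependent_not_subset_independent[OF _ X(1), of C] by (auto simp: mm_circuit_def)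
  have "y \<notin> B"
    using dependent_not_subset_independent[OF dep B] XB by blast
  have CB: "C \<subseteq> B \<union> \<omega>" using C(2) XB y(1) by blast
  have FC: "fundamental_circuit U \<Omega> r B \<omega> = C"
    unfolding fundamental_circuit_def
    using C(1) CB fundamental_circuit_unique[OF B \<omega>] by (intro the_equality conjI) auto
  have "C - B = {y}" using yC C(2) XB \<open>y \<notin> B\<close> by blast
  then show "exchange_elem U \<Omega> r B \<omega> = y"
    by (simp add: exchange_elem_def FC)
  have "min_elem \<Omega> R C = y"
  proof (rule min_elem_eqI[OF yC])
    fix v assume "v \<in> C" "v \<noteq> y"
    with C(2) obtain \<omega>' where "\<omega>' \<in> \<Omega>" "v \<in> \<omega>'" "(\<omega>, \<omega>') \<in> R"
      by (auto simp: above_def)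
    with \<omega> y(1) show "(skew_class_of \<Omega> y, skew_class_of \<Omega> v) \<in> R"
      by (simp add: skew_class_of_eq)
  qed
  then show "\<omega> \<in> act U \<Omega> r R B"
    using \<omega> C(1) CB y(1) by (auto simp: act_def has_fundamental_circuit_def FC)
qed

text \<open>The least element \<open>m\<close> of the fundamental circuit lies in \<omega>, so all
  other elements lie in greater classes, hence in \<open>above B \<omega>\<close>. Adding
  \<open>m\<close> to that independent set therefore makes it dependent, which means that the rank
  does not increase.\<close>

lemma active_imp_loop:
  assumes B: "mm_independent U \<Omega> r B" and act: "\<omega> \<in> act U \<Omega> r R B"
  shows "loops (above B \<omega>) \<omega> \<noteq> {}"
proof -
  let ?X = "above B \<omega>"
  define C where "C = fundamental_circuit U \<Omega> r B \<omega>"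
  define m where "m = min_elem \<Omega> R C"
  have \<omega>: "\<omega> \<in> \<Omega>" and ex: "\<exists>C. mm_circuit U \<Omega> r C \<and> C \<subseteq> B \<union> \<omega>" and m\<omega>: "m \<in> \<omega>"
    using act by (auto simp: act_def has_fundamental_circuit_def C_def m_def)
  then have "\<exists>!C. mm_circuit U \<Omega> r C \<and> C \<subseteq> B \<union> \<omega>"
    using fundamental_circuit_unique[OF B \<omega>] by blast
  from theI'[OF this] have C: "mm_circuit U \<Omega> r C" "C \<subseteq> B \<union> \<omega>"
    unfolding C_def fundamental_circuit_def by auto
  then have dep: "mm_dependent U \<Omega> r C" by (simp add: mm_circuit_def)
  then have st: "subtransversal U \<Omega> C" by (simp add: dependent_iff)
  have "C \<noteq> {}" using dep by (auto simp: dependent_iff)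
  have "C \<subseteq> insert m ?X"
  proof
    fix v assume v: "v \<in> C"
    show "v \<in> insert m ?X"
    proof (cases "v = m")
      case False
      obtain \<omega>' where \<omega>': "\<omega>' \<in> \<Omega>" "v \<in> \<omega>'"
        using v st partition by (auto simp: subtransversal_def partition_on_def)
      have "(skew_class_of \<Omega> m, skew_class_of \<Omega> v) \<in> R"
        using min_elem_least(2)[OF st \<open>C \<noteq> {}\<close> v] False by (simp add: m_def)
      then have lt: "(\<omega>, \<omega>') \<in> R"
        using \<omega> \<omega>' m\<omega> by (simp add: skew_class_of_eq)
      then have "v \<notin> \<omega>"
        using class_eq[OF \<omega> \<omega>'(1)] \<omega>'(2) order_irrefl by blast
      with v C(2) lt \<omega>' show ?thesis by (auto simp: above_def)
    qed simp
  qed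
  have XB: "?X \<subseteq> B" by (simp add: above_def)
  have X: "subtransversal U \<Omega> ?X" "r ?X = card ?X"
    using independent_subset[OF B XB] by (auto simp: independent_iff)
  have st: "subtransversal U \<Omega> (insert m ?X)"
    using subtransversal_insert[OF X(1) \<omega> above_disjoint[OF \<omega>] m\<omega>] .
  have "\<not> mm_independent U \<Omega> r (insert m ?X)"
    using dependent_not_subset_independent[OF dep] \<open>C \<subseteq> insert m ?X\<close> by blast
  then have "r (insert m ?X) < card (insert m ?X)"
    using st rank_le_card[OF st] by (simp add: independent_iff)
  also have "\<dots> \<le> Suc (r ?X)"
    using X by (simp add: card_insert_le_m1 card_insert_if finite_subtransversal)
  finally have "r (insert m ?X) = r ?X"
    using rank_mono[OF st subset_insertI] by simp
  with m\<omega> show ?thesis by (auto simp: loops_def)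
qed

lemma act_iff:
  assumes "mm_independent U \<Omega> r B" "\<omega> \<in> \<Omega>"
  shows "\<omega> \<in> act U \<Omega> r R B \<longleftrightarrow> loops (above B \<omega>) \<omega> \<noteq> {}"
  using above_loop_exchange(1)[OF assms] active_imp_loop[OF assms(1), of \<omega>] by blast

lemma exchange_elem_eq:
  assumes B: "mm_independent U \<Omega> r B" and act: "\<omega> \<in> act U \<Omega> r R B"
  shows "exchange_elem U \<Omega> r B \<omega> = the_elem (loops (above B \<omega>) \<omega>)"
proof -
  have \<omega>: "\<omega> \<in> \<Omega>" using act by (simp add: act_def)
  obtain y where y: "y \<in> loops (above B \<omega>) \<omega>"
    using active_imp_loop[OF assms] by blast
  have "subtransversal U \<Omega> (above B \<omega>)"
    using independent_subset[OF B, of "above B \<omega>"] by (auto simp: independent_iff above_def)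
  from loops_subset_singleton[OF this \<omega> above_disjoint[OF \<omega>] y]
  show ?thesis using above_loop_exchange(2)[OF B \<omega> y] by simp
qed

section \<open>The two sums and their recursions over the skew classes\<close>

context
  fixes x :: "'a \<Rightarrow> 'k::comm_ring_1" and t :: 'k and c :: "'a set \<Rightarrow> 'k"
  assumes c: "\<omega> \<in> \<Omega> \<Longrightarrow> of_nat (card \<omega> - 1) * c \<omega> = 1"
begin

text \<open>The factor \<open>c \<omega>\<close> stands for the inverse of
  \<open>card \<omega> - 1\<close>; postulating it allows any commutative ring, in particular one of
  polynomials. The value 0 in the case without a loop leaves the factor of an inactive
  class.\<close>

definition weight :: "'a set \<Rightarrow> 'a set \<Rightarrow> 'a \<Rightarrow> 'k" where
  "weight X \<omega> u =
    (if loops X \<omega> = {} then 0 else c \<omega> * t * x (the_elem (loops X \<omega>))) + x u"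

text \<open>\<open>S\<close> is the part already chosen in larger classes, and \<open>A\<close> is the set of the remaining
  classes: the following are the two sides of the theorem for the contraction by \<open>S\<close>.\<close>

definition transversal_sum :: "'a set \<Rightarrow> 'a set set \<Rightarrow> 'k" where
  "transversal_sum S A = (\<Sum>T | transversal (\<Union>A) A T.
    t ^ (card T + r S - r (S \<union> T)) * (\<Prod>u\<in>T. x u))"

definition basis_sum :: "'a set \<Rightarrow> 'a set set \<Rightarrow> 'k" where
  "basis_sum S A = (\<Sum>T | transversal (\<Union>A) A T.
    if r (S \<union> T) = r S + card T
    then \<Prod>\<omega>\<in>A. weight (S \<union> above T \<omega>) \<omega> (elem_in_class T \<omega>) else 0)"

text \<open>The exponent is the nullity of \<open>T\<close> in the contraction by \<open>S\<close>.
  Moving \<open>u\<close> from the transversal into \<open>S\<close> lowers it by one if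
  \<open>u\<close> is a loop over \<open>S\<close>, and leaves it unchanged otherwise.\<close>

lemma transversal_sum_insert:
  assumes S: "subtransversal U \<Omega> S" and A: "insert \<omega> A \<subseteq> \<Omega>" "\<omega> \<notin> A"
    and disj: "S \<inter> \<Union>(insert \<omega> A) = {}"
  shows "transversal_sum S (insert \<omega> A) =
    (\<Sum>u\<in>\<omega>. (if u \<in> loops S \<omega> then t else 1) * x u * transversal_sum (insert u S) A)"
proof -
  have \<omega>A: "\<omega> \<inter> \<Union>A = {}" using A class_eq by blast
  show ?thesis
    unfolding transversal_sum_def sum_transversal_insert[OF \<omega>A] sum_distrib_left
  proof (intro sum.cong refl, unfold mem_Collect_eq)
    fix u T assume u: "u \<in> \<omega>" and T: "transversal (\<Union>A) A T"
    have Su: "subtransversal U \<Omega> (insert u S)"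
      using subtransversal_insert[OF S _ _ u] A disj by auto
    have "u \<notin> \<Union>A" using u \<omega>A by blast
    then have "insert u S \<inter> \<Union>A = {}" using disj by auto
    then have un: "subtransversal U \<Omega> (insert u S \<union> T)"
      using subtransversal_Un[OF Su _ _ T] A by auto
    then have "finite T"
      using finite_subtransversal[OF un] by simp
    have "u \<notin> T" using \<open>u \<notin> \<Union>A\<close> T by (auto simp: transversal_def)
    have le: "r (insert u S \<union> T) \<le> r (insert u S) + card T"
      using rank_Un_le[OF un] .
    have "r S \<le> r (insert u S)" "r (insert u S) \<le> Suc (r S)"
      using rank_mono[OF Su subset_insertI] rank_insert_le[OF Su] by auto
    \<comment> \<open>No subtraction truncates here, by \<open>le\<close> and because
      \<open>u\<close> adds at most one to the rank of \<open>S\<close>.\<close>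
    then have "card (insert u T) + r S - r (S \<union> insert u T) =
        (if u \<in> loops S \<omega> then 1 else 0) + (card T + r (insert u S) - r (insert u S \<union> T))"
      using le \<open>u \<notin> T\<close> \<open>finite T\<close> u by (auto simp: loops_def)
    then show "t ^ (card (insert u T) + r S - r (S \<union> insert u T)) * prod x (insert u T) =
        (if u \<in> loops S \<omega> then t else 1) * x u *
          (t ^ (card T + r (insert u S) - r (insert u S \<union> T)) * prod x T)"
      using \<open>u \<notin> T\<close> \<open>finite T\<close> by (simp only: prod.insert) (simp add: mult_ac)
  qed
qed

text \<open>A loop over \<open>S\<close> occurs in no independent choice. Since \<omega> is the
  greatest remaining class, the new transversal has no elements above it, so the weight of \<omega>
  depends on \<open>S\<close> and \<open>u\<close> only and can be factored out.\<close>

lemma basis_sum_insert: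
  assumes S: "subtransversal U \<Omega> S" and A: "insert \<omega> A \<subseteq> \<Omega>" "\<omega> \<notin> A"
    and disj: "S \<inter> \<Union>(insert \<omega> A) = {}"
    and greatest: "\<And>\<omega>'. \<omega>' \<in> A \<Longrightarrow> (\<omega>', \<omega>) \<in> R"
  shows "basis_sum S (insert \<omega> A) =
    (\<Sum>u\<in>\<omega>. if u \<in> loops S \<omega> then 0 else weight S \<omega> u * basis_sum (insert u S) A)"
proof -
  have \<omega>A: "\<omega> \<inter> \<Union>A = {}" using A class_eq by blast
  have finA: "finite A" using A finite_classes finite_subset by auto
  have *: "(if r (S \<union> insert u T) = r S + card (insert u T)
      then \<Prod>\<omega>'\<in>insert \<omega> A. weight (S \<union> above (insert u T) \<omega>') \<omega>' (elem_in_class (insert u T) \<omega>')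
      else 0) =
    (if u \<in> loops S \<omega> then 0 else weight S \<omega> u *
      (if r (insert u S \<union> T) = r (insert u S) + card T
       then \<Prod>\<omega>'\<in>A. weight (insert u S \<union> above T \<omega>') \<omega>' (elem_in_class T \<omega>') else 0))"
    if u: "u \<in> \<omega>" and T: "transversal (\<Union>A) A T" for u T
  proof -
    have Su: "subtransversal U \<Omega> (insert u S)"
      using subtransversal_insert[OF S _ _ u] A disj by auto
    have "u \<notin> \<Union>A" using u \<omega>A by blast
    then have "insert u S \<inter> \<Union>A = {}" using disj by auto
    then have un: "subtransversal U \<Omega> (insert u S \<union> T)"
      using subtransversal_Un[OF Su _ _ T] A by auto
    then have "finite T"
      using finite_subtransversal[OF un] by simp
    have "u \<notin> T" using \<open>u \<notin> \<Union>A\<close> T by (auto simp: transversal_def)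
    have "r S \<le> r (insert u S)" "r (insert u S) \<le> Suc (r S)"
      using rank_mono[OF Su subset_insertI] rank_insert_le[OF Su] by auto
    \<comment> \<open>The rank grows by at most one when \<open>u\<close> is added to
      \<open>S\<close>, and by at most \<open>card T\<close> when \<open>T\<close> follows. The
      total growth is maximal exactly if both steps are.\<close>
    then have iff: "r (S \<union> insert u T) = r S + card (insert u T) \<longleftrightarrow>
        u \<notin> loops S \<omega> \<and> r (insert u S \<union> T) = r (insert u S) + card T"
      using rank_Un_le[OF un] \<open>u \<notin> T\<close> \<open>finite T\<close> u by (auto simp: loops_def)
    have T\<omega>: "T \<inter> \<omega> = {}" "T \<subseteq> \<Union>A" using T \<omega>A by (auto simp: transversal_def)
    have "above (insert u T) \<omega> = {}"
    proof (rule ccontr)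
      assume "above (insert u T) \<omega> \<noteq> {}"
      then obtain v \<omega>' where v: "v \<in> insert u T" "v \<in> \<omega>'" "\<omega>' \<in> \<Omega>" "(\<omega>, \<omega>') \<in> R"
        unfolding above_def by blast
      show False
      proof (cases "v = u")
        case True
        then show False using v u A class_eq order_irrefl by blast
      next
        case False
        then obtain \<omega>'' where "\<omega>'' \<in> A" "v \<in> \<omega>''" using v T\<omega> by blast
        then have "\<omega>'' = \<omega>'" using v A class_eq by blast
        then show False using greatest \<open>\<omega>'' \<in> A\<close> v order_asym by blast
      qed
    qed
    moreover have "insert u T \<inter> \<omega> = {u}" using u T\<omega> by blast
    then have "elem_in_class (insert u T) \<omega> = u" by (simp add: elem_in_class_def)
    \<comment> \<open>The class of \<open>u\<close> is above every class in \<open>A\<close>, so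
      \<open>u\<close> merely passes from the part above \<omega>' to the part already
      chosen.\<close>
    moreover have "S \<union> above (insert u T) \<omega>' = insert u S \<union> above T \<omega>'" if "\<omega>' \<in> A" for \<omega>'
      using greatest[OF that] A u by (auto simp: above_def)
    moreover have "insert u T \<inter> \<omega>' = T \<inter> \<omega>'" if "\<omega>' \<in> A" for \<omega>'
      using \<open>u \<notin> \<Union>A\<close> that by blast
    then have "elem_in_class (insert u T) \<omega>' = elem_in_class T \<omega>'" if "\<omega>' \<in> A" for \<omega>'
      using that by (simp add: elem_in_class_def)
    ultimately show ?thesis
      unfolding iff using A(2) finA by simp
  qed
  have "basis_sum S (insert \<omega> A) =
    (\<Sum>u\<in>\<omega>. \<Sum>T | transversal (\<Union>A) A T. if u \<in> loops S \<omega> then 0 else weight S \<omega> u *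
      (if r (insert u S \<union> T) = r (insert u S) + card T
       then \<Prod>\<omega>'\<in>A. weight (insert u S \<union> above T \<omega>') \<omega>' (elem_in_class T \<omega>') else 0))"
    unfolding basis_sum_def sum_transversal_insert[OF \<omega>A] by (intro sum.cong refl *) auto
  also have "\<dots> = (\<Sum>u\<in>\<omega>. if u \<in> loops S \<omega> then 0 else weight S \<omega> u * basis_sum (insert u S) A)"
    unfolding basis_sum_def sum_distrib_left by (intro sum.cong refl) auto
  finally show ?thesis .
qed

text \<open>The increment of \<open>u\<close> is the same over \<open>S\<close> and over
  \<open>S \<union> T\<close>: zero if \<open>u\<close> is the loop \<open>y\<close>, and one
  otherwise by R2. It therefore cancels in the exponent.\<close>

lemma transversal_sum_insert_eq:
  assumes S: "subtransversal U \<Omega> S" and A: "insert \<omega> A \<subseteq> \<Omega>" "\<omega> \<notin> A"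
    and disj: "S \<inter> \<Union>(insert \<omega> A) = {}" and y: "y \<in> loops S \<omega>" and u: "u \<in> \<omega>"
  shows "transversal_sum (insert u S) A = transversal_sum S A"
  unfolding transversal_sum_def
proof (intro sum.cong refl, clarsimp)
  fix T assume T: "transversal (\<Union>A) A T"
  have \<omega>A: "\<omega> \<inter> \<Union>A = {}" using A class_eq by blast
  have un: "subtransversal U \<Omega> (S \<union> T)"
    using subtransversal_Un[OF S _ _ T] A disj by auto
  have \<omega>: "\<omega> \<in> \<Omega>" "\<omega> \<inter> S = {}" "\<omega> \<inter> (S \<union> T) = {}"
    using A disj \<omega>A T by (auto simp: transversal_def)
  have y: "y \<in> \<omega>" "r (insert y S) = r S" using y by (auto simp: loops_def)
  \<comment> \<open>The loop persists over the larger set, so R2 can be used there as well.\<close>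
  have y': "r (insert y (S \<union> T)) = r (S \<union> T)"
    using rank_insert_eq_mono[OF y(2) _ subtransversal_insert[OF un \<omega>(1,3) y(1)]] by simp
  have "card T + r (insert u S) - r (insert u (S \<union> T)) = card T + r S - r (S \<union> T)"
  proof (cases "u = y")
    case False
    then show ?thesis
      using rank_insert_skew[OF S \<omega>(1,2) y(1) u _ y(2)]
        rank_insert_skew[OF un \<omega>(1,3) y(1) u _ y'] by simp
  qed (simp add: y y')
  then show "t ^ (card T + r (insert u S) - r (insert u (S \<union> T))) * prod x T =
      t ^ (card T + r S - r (S \<union> T)) * prod x T" by simp
qed

text \<open>The induction removes the greatest class of \<open>A\<close>. The set \<open>S\<close>
  must stay arbitrary because it grows by the element chosen in that class.\<close>

lemma transversal_sum_eq_basis_sum: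
  assumes "A \<subseteq> \<Omega>" "subtransversal U \<Omega> S" "S \<inter> \<Union>A = {}"
  shows "transversal_sum S A = basis_sum S A"
  using finite_subset[OF assms(1) finite_classes] assms
proof (induction A arbitrary: S rule: finite_psubset_induct)
  case (psubset A)
  show ?case
  proof (cases "A = {}")
    case True
    \<comment> \<open>With no class left, the empty transversal is the only term and both sums are
      1.\<close>
    have "transversal {} {} T \<longleftrightarrow> T = {}" for T :: "'a set" by (auto simp: transversal_def)
    with True show ?thesis by (simp add: transversal_sum_def basis_sum_def)
  next
    case False
    with psubset.prems(1) obtain \<omega> where \<omega>: "\<omega> \<in> A"
      and greatest: "\<And>\<omega>'. \<omega>' \<in> A - {\<omega>} \<Longrightarrow> (\<omega>', \<omega>) \<in> R"
      using greatest_class by blast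
    define A' where "A' = A - {\<omega>}"
    have A: "A = insert \<omega> A'" "\<omega> \<notin> A'" using \<omega> by (auto simp: A'_def)
    note S = psubset.prems(2)
    note A\<Omega> = psubset.prems(1)[unfolded A(1)]
    note disj = psubset.prems(3)[unfolded A(1)]
    have \<omega>\<Omega>: "\<omega> \<in> \<Omega>" "\<omega> \<inter> S = {}" using A\<Omega> disj by auto
    have IH: "transversal_sum (insert u S) A' = basis_sum (insert u S) A'" if u: "u \<in> \<omega>" for u
    proof (rule psubset.IH)
      have "u \<notin> \<Union>A'" using u A\<Omega> A(2) class_eq by blast
      then show "insert u S \<inter> \<Union>A' = {}" using disj by auto
    qed (use A A\<Omega> subtransversal_insert[OF S \<omega>\<Omega> u] in auto)
    have trans: "transversal_sum S A =
        (\<Sum>u\<in>\<omega>. (if u \<in> loops S \<omega> then t else 1) * x u * basis_sum (insert u S) A')"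
      unfolding A(1) transversal_sum_insert[OF S A\<Omega> A(2) disj] by (simp add: IH)
    have bas: "basis_sum S A =
        (\<Sum>u\<in>\<omega>. if u \<in> loops S \<omega> then 0 else weight S \<omega> u * basis_sum (insert u S) A')"
      unfolding A(1) using greatest
      by (intro basis_sum_insert[OF S A\<Omega> A(2) disj]) (simp add: A'_def)
    show ?thesis
    proof (cases "loops S \<omega> = {}")
      case True
      then show ?thesis unfolding trans bas by (simp add: weight_def)
    next
      case False
      then obtain y where "y \<in> loops S \<omega>" by blast
      then have loops: "loops S \<omega> = {y}"
        by (rule loops_subset_singleton[OF S \<omega>\<Omega>])
      then have y: "y \<in> \<omega>" by (auto simp: loops_def)
      have fin: "finite \<omega>"
        using class_subset[OF \<omega>\<Omega>(1)] finite_ground finite_subset by auto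
      let ?K = "transversal_sum S A'"
      \<comment> \<open>All choices in a class with a loop lead to the same remaining sum
        \<open>?K\<close>, which can be factored out.\<close>
      have K: "basis_sum (insert u S) A' = ?K" if "u \<in> \<omega>" for u
        using IH[OF that] transversal_sum_insert_eq[OF S A\<Omega> A(2) disj \<open>y \<in> loops S \<omega>\<close> that]
        by simp
      have "basis_sum S A = (\<Sum>u\<in>\<omega> - {y}. (c \<omega> * t * x y + x u) * ?K)"
        unfolding bas sum.remove[OF fin y] by (simp add: loops K weight_def)
      \<comment> \<open>The term with \<open>t * x y\<close> does not depend on \<open>u\<close> and
        occurs once for each of the \<open>card \<omega> - 1\<close> other elements; the factor
        \<open>c \<omega>\<close> compensates for this number.\<close>
      also have "\<dots> = of_nat (card \<omega> - 1) * c \<omega> * (t * x y * ?K) + (\<Sum>u\<in>\<omega> - {y}. x u * ?K)"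
        using y by (simp add: distrib_right sum.distrib card_Diff_singleton mult.assoc)
      also have "\<dots> = t * x y * ?K + (\<Sum>u\<in>\<omega> - {y}. x u * ?K)"
        by (simp only: c[OF \<omega>\<Omega>(1)] mult_1)
      also have "\<dots> = transversal_sum S A"
        unfolding trans sum.remove[OF fin y] by (simp add: loops K y)
      finally show ?thesis by simp
    qed
  qed
qed

section \<open>The expansion over bases in an arbitrary commutative ring\<close>

lemma basis_expansion:
  "(\<Sum>T | transversal U \<Omega> T. t ^ nullity r T * (\<Prod>u\<in>T. x u)) =
    (\<Sum>B | mm_basis U \<Omega> r B.
      (\<Prod>\<omega>\<in>inact U \<Omega> r R B. x (elem_in_class B \<omega>)) *
      (\<Prod>\<omega>\<in>act U \<Omega> r R B. c \<omega> * t * x (exchange_elem U \<Omega> r B \<omega>) + x (elem_in_class B \<omega>)))"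
proof -
  have U: "\<Union>\<Omega> = U" using partition by (simp add: partition_on_def)
  have empty: "subtransversal U \<Omega> {}" by (simp add: subtransversal_def)
  have r0: "r {} = 0" using rank_le_card[OF empty] by simp
  have fin: "finite {T. transversal U \<Omega> T}"
    by (rule finite_subset[of _ "Pow U"]) (auto simp: transversal_def finite_ground)
  have "(\<Prod>\<omega>\<in>\<Omega>. weight (above B \<omega>) \<omega> (elem_in_class B \<omega>)) =
      (\<Prod>\<omega>\<in>inact U \<Omega> r R B. x (elem_in_class B \<omega>)) *
      (\<Prod>\<omega>\<in>act U \<Omega> r R B. c \<omega> * t * x (exchange_elem U \<Omega> r B \<omega>) + x (elem_in_class B \<omega>))"
    if "mm_basis U \<Omega> r B" for B
  proof -
    have B: "mm_independent U \<Omega> r B" using that by (simp add: mm_basis_def)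
    have sub: "act U \<Omega> r R B \<subseteq> \<Omega>" by (auto simp: act_def)
    \<comment> \<open>An inactive class has no loop over the part of \<open>B\<close> above it; in
      an active one the loop is the exchange element. The weights thus become the two kinds of
      factors.\<close>
    have "(\<Prod>\<omega>\<in>inact U \<Omega> r R B. weight (above B \<omega>) \<omega> (elem_in_class B \<omega>)) =
        (\<Prod>\<omega>\<in>inact U \<Omega> r R B. x (elem_in_class B \<omega>))"
      by (rule prod.cong) (auto simp: inact_def weight_def act_iff[OF B])
    moreover have "(\<Prod>\<omega>\<in>act U \<Omega> r R B. weight (above B \<omega>) \<omega> (elem_in_class B \<omega>)) =
        (\<Prod>\<omega>\<in>act U \<Omega> r R B. c \<omega> * t * x (exchange_elem U \<Omega> r B \<omega>) + x (elem_in_class B \<omega>))"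
      using active_imp_loop[OF B]
      by (intro prod.cong) (auto simp: weight_def exchange_elem_eq[OF B])
    ultimately show ?thesis
      using prod.subset_diff[OF sub finite_classes,
          of "\<lambda>\<omega>. weight (above B \<omega>) \<omega> (elem_in_class B \<omega>)"]
      by (simp add: inact_def)
  qed
  then have "(\<Sum>B | mm_basis U \<Omega> r B.
      (\<Prod>\<omega>\<in>inact U \<Omega> r R B. x (elem_in_class B \<omega>)) *
      (\<Prod>\<omega>\<in>act U \<Omega> r R B. c \<omega> * t * x (exchange_elem U \<Omega> r B \<omega>) + x (elem_in_class B \<omega>))) =
    (\<Sum>B | transversal U \<Omega> B \<and> r B = card B.
      \<Prod>\<omega>\<in>\<Omega>. weight (above B \<omega>) \<omega> (elem_in_class B \<omega>))"
    by (intro sum.cong) (auto simp: basis_iff[OF non_degenerate])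
  \<comment> \<open>Transversals that are not independent contribute zero to
    \<open>basis_sum\<close>, so only bases remain.\<close>
  also have "\<dots> = basis_sum {} \<Omega>"
    unfolding basis_sum_def U by (simp add: r0 sum.If_cases[OF fin] Collect_conj_eq)
  also have "\<dots> = transversal_sum {} \<Omega>"
    by (rule transversal_sum_eq_basis_sum[symmetric]) (auto simp: empty)
  also have "\<dots> = (\<Sum>T | transversal U \<Omega> T. t ^ nullity r T * (\<Prod>u\<in>T. x u))"
    by (simp add: transversal_sum_def U r0 nullity_def)
  finally show ?thesis by simp
qed

end

end

text \<open>For \<open>n \<ge> 2\<close> the number \<open>n - 1\<close> is positive, hence non-zero
  in characteristic zero, and truncated subtraction agrees with subtraction in the field. Constant
  polynomials multiply like their coefficients.\<close>

lemma of_nat_mult_mconst_inverse: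
  assumes "n \<ge> 2"
  shows "of_nat (n - 1) * mconst (1 / (of_nat n - 1)) = (1 :: ('a, 'k::field_char_0) mpoly)"
proof -
  have "of_nat n - 1 = (of_nat (n - 1) :: 'k)"
    using assms by (simp add: of_nat_diff)
  moreover have "of_nat (n - 1) \<noteq> (0 :: 'k)"
    using assms by simp
  moreover have "of_nat (n - 1) = (Poly_Mapping.single 0 (of_nat (n - 1)) :: ('a, 'k) mpoly)"
    by simp
  ultimately show ?thesis
    by (simp add: mconst_def mult_single del: single_of_nat of_nat_diff)
qed

theorem theorem3p5:
  fixes U :: "'a set" and \<Omega> :: "'a set set" and r :: "'a set \<Rightarrow> nat"
    and R :: "('a set \<times> 'a set) set"
  assumes "multimatroid U \<Omega> r"
    and "non_degenerate \<Omega>"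
    and "strict_linear_order_on \<Omega> R"
  shows "(transition_poly U \<Omega> r :: ('a, 'k::field_char_0) mpoly) =
    (\<Sum>B | mm_basis U \<Omega> r B.
       (\<Prod>\<omega>\<in>inact U \<Omega> r R B. x_var (elem_in_class B \<omega>)) *
       (\<Prod>\<omega>\<in>act U \<Omega> r R B.
          (mconst (1 / (of_nat (card \<omega>) - 1)) * t_var * x_var (exchange_elem U \<Omega> r B \<omega>)
           + x_var (elem_in_class B \<omega>))))"
proof -
  interpret ordered_multimatroid U \<Omega> r R
    by (intro ordered_multimatroid.intro ordered_multimatroid_axioms.intro assms)
  have "of_nat (card \<omega> - 1) * mconst (1 / (of_nat (card \<omega>) - 1)) = (1 :: ('a, 'k) mpoly)"
    if "\<omega> \<in> \<Omega>" for \<omega>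
    using that assms(2) by (intro of_nat_mult_mconst_inverse) (simp add: non_degenerate_def)
  \<comment> \<open>The ring is now the polynomial ring, with the indeterminates themselves as the
    values of \<open>x\<close> and \<open>t\<close>.\<close>
  from basis_expansion[of "\<lambda>\<omega>. mconst (1 / (of_nat (card \<omega>) - 1))", OF this]
  show ?thesis
    unfolding transition_poly_def .
qed

end
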